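(* Let $n\ge2$ and $\sigma>0$. For $\phi\in[-1,1]$ let $\mu_\phi$ be the law on $\mathbb R^n$ of the centered weakly stationary Gaussian AR(1) process of length $n$ with marginal variance $\sigma^2$, i.e. the centered Gaussian measure with covariance matrix $(\sigma^2\phi^{|i-j|})_{i,j=1}^n$, and let $\mu_b=\mu_1$ be the base measure, corresponding to $\phi=1$ (covariance matrix with all entries $\sigma^2$). Then the $\mathrm{WCP}_2$ prior density for $\phi$ with respect to $\mu_b$ and with hyperparameter $\eta>0$ is, for $\phi\in(-1,1)$, $$\pi(\phi)=\sigma\left|\frac{(n\phi^n-1+\phi^n-n\phi)(1-\phi)+f_n(\phi)^2}{\sqrt2\,f_n(\phi)\sqrt{n-\frac{f_n(\phi)}{1-\phi}}\,(1-\phi)^2}\right|\frac{\eta\exp\left(-\sqrt2\,\eta\,\sigma\sqrt{n-\frac{f_n(\phi)}{1-\phi}}\right)}{1-\exp(-\eta c)},$$ where $f_n(\phi)=\sqrt{n(1-\phi^2)-2\phi(1-\phi^n)}$ and $c=\sigma\bigl(2n-\sqrt2\sqrt{1-(-1)^n}\bigr)^{1/2}$.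
   Context: The AR(1) process: $X_t=\phi X_{t-1}+\varepsilon_t$, $X_0\sim\mathcal N(0,\sigma^2)$, $|\phi|\le1$, with $\varepsilon_t$ i.i.d. $\mathcal N(0,\sigma^2(1-\phi^2))$ independent of $X_0$; it is observed at $t=1,\dots,n$. Wasserstein distance on $\mathbb R^n$ (Euclidean norm): $W_2(\mu,\nu)=\bigl(\inf_{\pi\in\Pi(\mu,\nu)}\int\|x-y\|^2\,d\pi(x,y)\bigr)^{1/2}$, $\Pi(\mu,\nu)$ the couplings of $\mu,\nu$. One-sided univariate $\mathrm{WCP}_p$ prior. Let $\{\mu_\theta:\theta\in(\theta_-,\theta_+)\}$ be a model class with finite $p$th moments and base measure $\mu_b$ corresponding to a boundary value $\theta_b\in\{\theta_-,\theta_+\}$ of the parameter interval. Put $W_p(\theta)=W_p(\mu_\theta,\mu_b)$ and $c=\sup_\theta W_p(\theta)\in(0,\infty]$, assuming $W_p(\cdot)$ is injective and differentiable, tends to $0$ as $\theta\to\theta_b$ and to $c$ at the other endpoint. For $\eta>0$ the $\mathrm{WCP}_p$ prior density of $\theta$ is $$\pi(\theta)=\frac{\eta\,e^{-\eta W_p(\theta)}}{1-e^{-\eta c}}\left|\frac{dW_p(\theta)}{d\theta}\right|,\qquad e^{-\infty}:=0.$$ Here $p=2$, $\theta=\phi\in(-1,1)$, $\theta_b=1$. *)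

theory Defs
  imports "HOL-Probability.Probability"
begin

definition couplings ::
  "'a::euclidean_space measure \<Rightarrow> 'a measure \<Rightarrow> ('a \<times> 'a) measure set" where
  "couplings M N =
     {P. sets P = sets (M \<Otimes>\<^sub>M N) \<and> distr P M fst = M \<and> distr P N snd = N}"

text \<open>The infimum is taken in \<^typ>\<open>ennreal\<close>. It is finite, so that passing to the reals loses
  nothing, as soon as both measures are probability measures with finite \<open>p\<close>-th moments.\<close>

definition wasserstein :: "real \<Rightarrow> 'a::euclidean_space measure \<Rightarrow> 'a measure \<Rightarrow> real" where
  "wasserstein p M N =
     enn2real (INF P\<in>couplings M N. \<integral>\<^sup>+z. ennreal (norm (fst z - snd z) powr p) \<partial>P) powr (1 / p)"

definition finite_moment :: "real \<Rightarrow> 'a::euclidean_space measure \<Rightarrow> bool" where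
  "finite_moment p M \<longleftrightarrow>
     prob_space M \<and> sets M = sets borel \<and> integrable M (\<lambda>x. norm x powr p)"

definition wcp_sup ::
  "real \<Rightarrow> real \<Rightarrow> real \<Rightarrow> (real \<Rightarrow> 'a::euclidean_space measure) \<Rightarrow> 'a measure \<Rightarrow> ereal" where
  "wcp_sup p lo hi \<mu> \<mu>b = (SUP \<theta>\<in>{lo<..<hi}. ereal (wasserstein p (\<mu> \<theta>) \<mu>b))"

text \<open>The conditions under which the one-sided univariate \<open>WCP\<^sub>p\<close> prior is defined, for a model
  class \<open>\<mu>\<close> with (bounded) parameter interval \<open>{lo<..<hi}\<close> and a base measure \<open>\<mu>b\<close> attached to the
  endpoint \<open>b\<close>.\<close>

definition wcp_model ::
  "real \<Rightarrow> real \<Rightarrow> real \<Rightarrow> real \<Rightarrow> (real \<Rightarrow> 'a::euclidean_space measure) \<Rightarrow> 'a measure \<Rightarrow> bool" where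
  "wcp_model p lo hi b \<mu> \<mu>b \<longleftrightarrow>
     1 \<le> p \<and> lo < hi \<and> b \<in> {lo, hi} \<and>
     finite_moment p \<mu>b \<and> (\<forall>\<theta>\<in>{lo<..<hi}. finite_moment p (\<mu> \<theta>)) \<and>
     0 < wcp_sup p lo hi \<mu> \<mu>b \<and>
     inj_on (\<lambda>\<theta>. wasserstein p (\<mu> \<theta>) \<mu>b) {lo<..<hi} \<and>
     (\<lambda>\<theta>. wasserstein p (\<mu> \<theta>) \<mu>b) differentiable_on {lo<..<hi} \<and>
     ((\<lambda>\<theta>. wasserstein p (\<mu> \<theta>) \<mu>b) \<longlongrightarrow> 0) (at b within {lo<..<hi}) \<and>
     ((\<lambda>\<theta>. ereal (wasserstein p (\<mu> \<theta>) \<mu>b)) \<longlongrightarrow> wcp_sup p lo hi \<mu> \<mu>b)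
       (at (if b = lo then hi else lo) within {lo<..<hi})"

definition wcp_density ::
  "real \<Rightarrow> real \<Rightarrow> real \<Rightarrow> (real \<Rightarrow> 'a::euclidean_space measure) \<Rightarrow> 'a measure \<Rightarrow> real \<Rightarrow> real \<Rightarrow> real"
where
  "wcp_density p lo hi \<mu> \<mu>b \<eta> \<theta> =
     (let W = (\<lambda>t. wasserstein p (\<mu> t) \<mu>b);
          c = wcp_sup p lo hi \<mu> \<mu>b;
          e = (if c = \<infinity> then 0 else exp (- \<eta> * real_of_ereal c))
      in \<eta> * exp (- \<eta> * W \<theta>) / (1 - e) * \<bar>deriv W \<theta>\<bar>)"

text \<open>The normal law with mean \<open>0\<close> and standard deviation \<open>s \<ge> 0\<close>. The case \<open>s = 0\<close> is separate
  because \<^term>\<open>normal_density 0 0\<close> is the zero function.\<close>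

definition centered_normal :: "real \<Rightarrow> real measure" where
  "centered_normal s = (if s = 0 then return borel 0 else density lborel (normal_density 0 s))"

text \<open>Possibly degenerate Gaussian measures: all linear functionals have (possibly degenerate)
  centered normal laws, and \<open>S\<close> is the matrix of second moments.\<close>

definition centered_gaussian :: "real^'n^'n \<Rightarrow> (real^'n::finite) measure \<Rightarrow> bool" where
  "centered_gaussian S M \<longleftrightarrow>
     prob_space M \<and> sets M = sets borel \<and>
     (\<forall>a. \<exists>s\<ge>0. distr M borel (\<lambda>x. a \<bullet> x) = centered_normal s) \<and>
     (\<forall>i j. (\<integral>x. x $ i * x $ j \<partial>M) = S $ i $ j)"

text \<open>\<open>idx\<close> numbers the coordinates of the space by \<open>1, \<dots>, n\<close>.\<close>

definition ar1_cov :: "('n::finite \<Rightarrow> nat) \<Rightarrow> real \<Rightarrow> real \<Rightarrow> real^'n^'n" where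
  "ar1_cov idx \<sigma> \<phi> = (\<chi> i j. \<sigma>\<^sup>2 * \<phi> ^ nat \<bar>int (idx i) - int (idx j)\<bar>)"

definition ar1_f :: "nat \<Rightarrow> real \<Rightarrow> real" where
  "ar1_f n \<phi> = sqrt (real n * (1 - \<phi>\<^sup>2) - 2 * \<phi> * (1 - \<phi> ^ n))"

definition ar1_c :: "nat \<Rightarrow> real \<Rightarrow> real" where
  "ar1_c n \<sigma> = \<sigma> * sqrt (2 * real n - sqrt 2 * sqrt (1 - (-1) ^ n))"

end

theory Submission
  imports Defs
begin

text \<open>The law \<open>\<mu>\<^sub>1\<close> is concentrated on the diagonal: it is the law of \<open>Z u\<close> with \<open>u = (\<sigma>, \<dots>, \<sigma>)\<close> and
  \<open>Z\<close> standard normal. For a coupling of a centered Gaussian \<open>X\<close> with covariance \<open>S\<close> and such a \<open>Z u\<close>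
  only \<open>E[Z (u \<bullet> X)]\<close> matters, which by Cauchy--Schwarz is at most \<open>sqrt (u \<bullet> S u)\<close>, with equality
  for \<open>Z = (u \<bullet> X) / sqrt (u \<bullet> S u)\<close>. Hence
  \<open>W\<^sub>2\<^sup>2 = tr S + |u|\<^sup>2 - 2 sqrt (u \<bullet> S u)\<close>, and for AR(1) this is
  \<open>2 \<sigma>\<^sup>2 (n - sqrt Q)\<close> with \<open>Q = \<Sum> \<phi>\<^bsup>|i - j|\<^esup> = (f\<^sub>n(\<phi>) / (1 - \<phi>))\<^sup>2\<close>. All the conditions on the
  model then follow from \<open>Q\<close> being continuous and strictly increasing on \<open>[-1, 1]\<close>.\<close>

section \<open>Marginals and second moments of centered Gaussian measures\<close>

lemma centered_normal_second_moment:
  assumes "0 \<le> s"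
  shows "has_bochner_integral (centered_normal s) (\<lambda>x. x\<^sup>2) (s\<^sup>2)"
proof (cases "s = 0")
  case True
  have "has_bochner_integral (return borel (0::real)) (\<lambda>x. x\<^sup>2) 0 \<longleftrightarrow>
      has_bochner_integral (return borel (0::real)) (\<lambda>x. 0::real) 0"
    by (rule has_bochner_integral_cong_AE) (auto simp: AE_return)
  then show ?thesis
    using True by (simp add: centered_normal_def has_bochner_integral_zero)
next
  case False
  with assms have s: "0 < s" by simp
  have "has_bochner_integral lborel (\<lambda>x. normal_density 0 s x *\<^sub>R x\<^sup>2) (s\<^sup>2)"
    using normal_moment_even[OF s, of 0 1] by simp
  then show ?thesis
    using False
    by (simp add: centered_normal_def has_bochner_integral_density normal_density_nonneg)
qed

text \<open>\<open>centered_gaussian\<close> gives the second moments as Bochner integrals, which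
  are 0 by default for non-integrable functions. Integrability therefore comes from the normal
  marginals first; comparing second moments afterwards identifies the unknown standard deviation of
  each marginal.\<close>

lemma gaussian_inner:
  fixes S :: "real^'n^'n::finite"
  assumes G: "centered_gaussian S M"
  shows gaussian_integrable_inner_square: "integrable M (\<lambda>x. (a \<bullet> x)\<^sup>2)"
    and gaussian_integral_inner_square: "(\<integral>x. (a \<bullet> x)\<^sup>2 \<partial>M) = a \<bullet> (S *v a)"
    and gaussian_distr_inner: "distr M borel (\<lambda>x. a \<bullet> x) = centered_normal (sqrt (a \<bullet> (S *v a)))"
proof -
  have sets [measurable_cong]: "sets M = sets borel"
    using G by (simp add: centered_gaussian_def)
  have "\<exists>s\<ge>0. distr M borel (\<lambda>x. a \<bullet> x) = centered_normal s \<and>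
      has_bochner_integral M (\<lambda>x. (a \<bullet> x)\<^sup>2) (s\<^sup>2)" for a
  proof -
    obtain s where s: "s \<ge> 0" "distr M borel (\<lambda>x. a \<bullet> x) = centered_normal s"
      using G unfolding centered_gaussian_def by blast
    have "has_bochner_integral (distr M borel (\<lambda>x. a \<bullet> x)) (\<lambda>x. x\<^sup>2) (s\<^sup>2)"
      using s centered_normal_second_moment by simp
    then have "has_bochner_integral M (\<lambda>x. (a \<bullet> x)\<^sup>2) (s\<^sup>2)"
      by (auto simp: has_bochner_integral_iff integrable_distr_eq integral_distr)
    with s show ?thesis by blast
  qed
  note ex = this
  have sq: "integrable M (\<lambda>x. (a \<bullet> x)\<^sup>2)" for a
    using ex[of a] by (auto simp: has_bochner_integral_iff)
  have prod: "integrable M (\<lambda>x. x $ i * x $ j)" for i j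
  proof -
    \<comment> \<open>Polarization: the integrand is \<open>x $ i * x $ j\<close>, written with
      squares of linear functionals only.\<close>
    have "integrable M (\<lambda>x. (((axis i 1 + axis j 1) \<bullet> x)\<^sup>2 - (axis i 1 \<bullet> x)\<^sup>2 - (axis j 1 \<bullet> x)\<^sup>2) / 2)"
      using sq by (intro integrable_divide Bochner_Integration.integrable_diff)
    then show ?thesis
      by (simp add: inner_axis' inner_add_left power2_sum)
  qed
  have "(a \<bullet> x)\<^sup>2 = (\<Sum>i\<in>UNIV. \<Sum>j\<in>UNIV. a $ i * a $ j * (x $ i * x $ j))" for x
    by (simp add: inner_vec_def power2_eq_square sum_product algebra_simps)
  then have "(\<integral>x. (a \<bullet> x)\<^sup>2 \<partial>M) = (\<Sum>i\<in>UNIV. \<Sum>j\<in>UNIV. a $ i * a $ j * (\<integral>x. x $ i * x $ j \<partial>M))"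
    using prod by simp
  also have "\<dots> = (\<Sum>i\<in>UNIV. \<Sum>j\<in>UNIV. a $ i * a $ j * S $ i $ j)"
    using G by (simp add: centered_gaussian_def)
  also have "\<dots> = a \<bullet> (S *v a)"
    by (simp add: inner_vec_def matrix_vector_mult_def sum_distrib_left algebra_simps)
  finally have int: "(\<integral>x. (a \<bullet> x)\<^sup>2 \<partial>M) = a \<bullet> (S *v a)" .
  from ex[of a] int obtain s where s: "s \<ge> 0" "distr M borel (\<lambda>x. a \<bullet> x) = centered_normal s"
    "a \<bullet> (S *v a) = s\<^sup>2"
    by (auto simp: has_bochner_integral_iff)
  then show "distr M borel (\<lambda>x. a \<bullet> x) = centered_normal (sqrt (a \<bullet> (S *v a)))"
    by simp
  show "integrable M (\<lambda>x. (a \<bullet> x)\<^sup>2)" "(\<integral>x. (a \<bullet> x)\<^sup>2 \<partial>M) = a \<bullet> (S *v a)"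
    by (fact sq int)+
qed

lemma gaussian_norm_square:
  fixes S :: "real^'n^'n::finite"
  assumes G: "centered_gaussian S M"
  shows gaussian_integrable_norm_square: "integrable M (\<lambda>x. (norm x)\<^sup>2)"
    and gaussian_integral_norm_square: "(\<integral>x. (norm x)\<^sup>2 \<partial>M) = trace S"
proof -
  have eq: "(norm x)\<^sup>2 = (\<Sum>i\<in>UNIV. (axis i 1 \<bullet> x)\<^sup>2)" for x :: "real^'n"
    unfolding power2_norm_eq_inner inner_vec_def[of x x] by (simp add: inner_axis' power2_eq_square)
  show "integrable M (\<lambda>x. (norm x)\<^sup>2)"
    unfolding eq using gaussian_integrable_inner_square[OF G] by simp
  have "(\<integral>x. (norm x)\<^sup>2 \<partial>M) = (\<Sum>i\<in>UNIV. axis i 1 \<bullet> (S *v axis i 1))"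
    unfolding eq
    by (simp add: gaussian_integrable_inner_square[OF G] gaussian_integral_inner_square[OF G])
  then show "(\<integral>x. (norm x)\<^sup>2 \<partial>M) = trace S"
    by (simp add: trace_def inner_axis' matrix_vector_mult_basis column_def)
qed

lemma gaussian_finite_moment:
  fixes S :: "real^'n^'n::finite"
  assumes "centered_gaussian S M"
  shows "finite_moment 2 M"
  using assms gaussian_integrable_norm_square[OF assms]
  by (simp add: finite_moment_def centered_gaussian_def)

section \<open>Gaussian measures with rank-one covariance\<close>

definition rank_one :: "real^'n \<Rightarrow> real^'n^'n::finite" where
  "rank_one u = (\<chi> i j. u $ i * u $ j)"

lemma rank_one_quadratic: "a \<bullet> (rank_one u *v a) = (u \<bullet> a)\<^sup>2"
proof -
  have "rank_one u *v a = (u \<bullet> a) *\<^sub>R u"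
    by (simp add: vec_eq_iff rank_one_def matrix_vector_mult_def inner_vec_def
        sum_distrib_left sum_distrib_right algebra_simps)
  then show ?thesis by (simp add: power2_eq_square inner_commute)
qed

lemma trace_rank_one: "trace (rank_one u) = (norm u)\<^sup>2"
  unfolding power2_norm_eq_inner by (simp add: trace_def rank_one_def inner_vec_def)

text \<open>A functional orthogonal to \<open>u\<close> has second moment 0 under \<open>N\<close>,
  so it vanishes almost everywhere and \<open>N\<close> lives on the line spanned by
  \<open>u\<close>.\<close>

lemma rank_one_gaussian_AE:
  fixes u :: "real^'n::finite"
  assumes G: "centered_gaussian (rank_one u) N" and u: "u \<noteq> 0"
  shows "AE y in N. y = ((u \<bullet> y) / (u \<bullet> u)) *\<^sub>R u"
proof -
  have "AE y in N. y $ i = (u \<bullet> y) / (u \<bullet> u) * u $ i" for i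
  proof -
    \<comment> \<open>The part of the \<open>i\<close>-th unit vector orthogonal to
      \<open>u\<close>: the equation \<open>a \<bullet> y = 0\<close> is the claim for coordinate
      \<open>i\<close>.\<close>
    define a where "a = axis i 1 - (u $ i / (u \<bullet> u)) *\<^sub>R u"
    have "u \<bullet> a = 0"
      using u by (simp add: a_def inner_diff_right inner_axis)
    then have "(\<integral>y. (a \<bullet> y)\<^sup>2 \<partial>N) = 0"
      by (simp add: gaussian_integral_inner_square[OF G] rank_one_quadratic)
    then have "AE y in N. (a \<bullet> y)\<^sup>2 = 0"
      using integral_nonneg_eq_0_iff_AE[OF gaussian_integrable_inner_square[OF G, of a]] by simp
    then show ?thesis
      by eventually_elim (simp add: a_def inner_diff_left inner_axis')
  qed
  then have "AE y in N. \<forall>i. y $ i = (u \<bullet> y) / (u \<bullet> u) * u $ i"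
    by (subst AE_all_countable) blast
  then show ?thesis
    by eventually_elim (simp add: vec_eq_iff)
qed

text \<open>On the line spanned by \<open>u\<close> the point is recovered from one scalar, whose
  law is known. This uniqueness statement later identifies the second marginal of the optimal
  coupling with \<open>N\<close> itself.\<close>

lemma rank_one_gaussian_eq_distr:
  fixes u :: "real^'n::finite"
  assumes G: "centered_gaussian (rank_one u) N" and u: "u \<noteq> 0"
  shows "N = distr (centered_normal 1) borel (\<lambda>z. z *\<^sub>R u)"
proof -
  \<comment> \<open>Scaled so that \<open>u \<bullet> w = 1\<close>: the functional \<open>w\<close>
    reads off \<open>z\<close> from \<open>z *\<^sub>R u\<close>.\<close>
  define w where "w = (1 / (u \<bullet> u)) *\<^sub>R u"
  have sets [measurable_cong]: "sets N = sets borel"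
    using G by (simp add: centered_gaussian_def)
  have "N = distr N borel (\<lambda>y. y)"
    using distr_id2[of borel N] sets by simp
  also have "\<dots> = distr N borel (\<lambda>y. (w \<bullet> y) *\<^sub>R u)"
    by (rule distr_cong_AE) (use rank_one_gaussian_AE[OF G u] in \<open>auto simp: w_def\<close>)
  also have "\<dots> = distr (distr N borel (\<lambda>y. w \<bullet> y)) borel (\<lambda>z. z *\<^sub>R u)"
    by (simp add: distr_distr o_def)
  also have "distr N borel (\<lambda>y. w \<bullet> y) = centered_normal 1"
  proof -
    have "u \<bullet> w = 1" using u by (simp add: w_def)
    then show ?thesis by (simp add: gaussian_distr_inner[OF G] rank_one_quadratic)
  qed
  finally show ?thesis .
qed

section \<open>The Wasserstein distance from a Gaussian to a rank-one Gaussian\<close>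

lemma wasserstein_2_eq_sqrt:
  fixes M N :: "'a::euclidean_space measure"
  assumes "P0 \<in> couplings M N"
    and "(\<integral>\<^sup>+z. ennreal ((norm (fst z - snd z))\<^sup>2) \<partial>P0) = ennreal V"
    and "\<And>P. P \<in> couplings M N \<Longrightarrow> ennreal V \<le> (\<integral>\<^sup>+z. ennreal ((norm (fst z - snd z))\<^sup>2) \<partial>P)"
    and "0 \<le> V"
  shows "wasserstein 2 M N = sqrt V"
proof -
  have "(INF P\<in>couplings M N. \<integral>\<^sup>+z. ennreal ((norm (fst z - snd z))\<^sup>2) \<partial>P) = ennreal V"
  proof (rule antisym)
    show "(INF P\<in>couplings M N. \<integral>\<^sup>+z. ennreal ((norm (fst z - snd z))\<^sup>2) \<partial>P) \<le> ennreal V"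
      using INF_lower[OF assms(1), of "\<lambda>P. \<integral>\<^sup>+z. ennreal ((norm (fst z - snd z))\<^sup>2) \<partial>P"] assms(2)
      by simp
  qed (use assms(3) in \<open>auto intro: INF_greatest\<close>)
  then show ?thesis
    using assms(4) by (simp add: wasserstein_def powr_half_sqrt)
qed

text \<open>Weak Kantorovich duality: the cost dominates almost everywhere a function of
  \<open>fst z\<close> plus a function of \<open>snd z\<close>, and the integral of such a sum
  depends on the marginals alone.\<close>

lemma gaussian_rank_one_cost_ge:
  fixes S :: "real^'n^'n::finite" and u :: "real^'n"
  assumes M: "centered_gaussian S M" and N: "centered_gaussian (rank_one u) N"
    and pos: "0 < u \<bullet> (S *v u)" and P: "P \<in> couplings M N"
  shows "ennreal (trace S + (norm u)\<^sup>2 - 2 * sqrt (u \<bullet> (S *v u)))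
    \<le> (\<integral>\<^sup>+z. ennreal ((norm (fst z - snd z))\<^sup>2) \<partial>P)"
proof -
  define s where "s = sqrt (u \<bullet> (S *v u))"
  have s: "0 < s" "s\<^sup>2 = u \<bullet> (S *v u)" using pos by (simp_all add: s_def)
  have u: "u \<noteq> 0" using pos by auto
  define w where "w = (1 / (u \<bullet> u)) *\<^sub>R u"
  have setsM [measurable_cong]: "sets M = sets borel" and setsN [measurable_cong]: "sets N = sets borel"
    using M N by (simp_all add: centered_gaussian_def)
  have setsP [measurable_cong]: "sets P = sets (M \<Otimes>\<^sub>M N)"
    and marg: "distr P M fst = M" "distr P N snd = N"
    using P by (auto simp: couplings_def)
  have fstP [measurable]: "fst \<in> measurable P M" and sndP [measurable]: "snd \<in> measurable P N"
    by measurable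
  have int_fst: "has_bochner_integral P (\<lambda>z. g (fst z)) (integral\<^sup>L M g)" if "integrable M g"
    for g :: "real^'n \<Rightarrow> real"
    using that fstP marg(1) borel_measurable_integrable[OF that] integrable_distr_eq[OF fstP, of g] integral_distr[OF fstP, of g]
    by (simp add: has_bochner_integral_iff)
  have int_snd: "has_bochner_integral P (\<lambda>z. g (snd z)) (integral\<^sup>L N g)" if "integrable N g"
    for g :: "real^'n \<Rightarrow> real"
    using that sndP marg(2) borel_measurable_integrable[OF that] integrable_distr_eq[OF sndP, of g] integral_distr[OF sndP, of g]
    by (simp add: has_bochner_integral_iff)
  \<comment> \<open>From \<open>2 * Z * (u \<bullet> x) \<le> (u \<bullet> x)\<^sup>2 / s + s *
    Z\<^sup>2\<close> with \<open>Z = w \<bullet> y\<close>. The weight \<open>s\<close> makes both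
    terms on the right have mean \<open>s\<close>, so the bound is sharp for
    \<open>Z = (u \<bullet> x) / s\<close>.\<close>
  define R where "R z = (norm (fst z))\<^sup>2 + (norm (snd z))\<^sup>2 - (u \<bullet> fst z)\<^sup>2 / s - s * (w \<bullet> snd z)\<^sup>2"
    for z :: "(real^'n) \<times> (real^'n)"
  have "has_bochner_integral P R (trace S + (norm u)\<^sup>2 - s\<^sup>2 / s - s * 1)"
    unfolding R_def
  proof (intro has_bochner_integral_diff has_bochner_integral_add has_bochner_integral_divide_zero
      has_bochner_integral_mult_right)
    show "has_bochner_integral P (\<lambda>z. (norm (fst z))\<^sup>2) (trace S)"
      using int_fst[OF gaussian_integrable_norm_square[OF M]] gaussian_integral_norm_square[OF M] by simp
    show "has_bochner_integral P (\<lambda>z. (norm (snd z))\<^sup>2) ((norm u)\<^sup>2)"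
      using int_snd[OF gaussian_integrable_norm_square[OF N]] gaussian_integral_norm_square[OF N]
      by (simp add: trace_rank_one)
    show "has_bochner_integral P (\<lambda>z. (u \<bullet> fst z)\<^sup>2) (s\<^sup>2)"
      using int_fst[OF gaussian_integrable_inner_square[OF M]] gaussian_integral_inner_square[OF M]
      by (simp add: s)
    show "has_bochner_integral P (\<lambda>z. (w \<bullet> snd z)\<^sup>2) 1"
      using int_snd[OF gaussian_integrable_inner_square[OF N, of w]] gaussian_integral_inner_square[OF N, of w] u
      by (simp add: rank_one_quadratic w_def)
  qed
  then have R: "integrable P R" "(\<integral>z. R z \<partial>P) = trace S + (norm u)\<^sup>2 - 2 * s"
    using s(1) by (auto simp: has_bochner_integral_iff power2_eq_square)
  have "AE y in distr P N snd. y = (w \<bullet> y) *\<^sub>R u"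
    unfolding marg(2) using rank_one_gaussian_AE[OF N u] by (simp add: w_def)
  then have "AE z in P. snd z = (w \<bullet> snd z) *\<^sub>R u"
    by (rule AE_distrD[OF sndP])
  then have le: "AE z in P. R z \<le> (norm (fst z - snd z))\<^sup>2"
  proof eventually_elim
    case (elim z)
    define x y Z where "x = fst z" and "y = snd z" and "Z = w \<bullet> y"
    have y: "y = Z *\<^sub>R u" using elim by (simp only: y_def Z_def)
    have "0 \<le> (u \<bullet> x - s * Z)\<^sup>2 / s" using s by simp
    also have "\<dots> = (u \<bullet> x)\<^sup>2 / s + s * Z\<^sup>2 - 2 * (Z * (u \<bullet> x))"
      using s(1) by (simp add: power2_eq_square field_simps)
    also have "Z * (u \<bullet> x) = x \<bullet> y" by (simp add: y inner_commute)
    finally show ?case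
      unfolding R_def x_def[symmetric] y_def[symmetric] Z_def[symmetric] power2_norm_eq_inner
      by (simp add: inner_diff_left inner_diff_right inner_commute)
  qed
  \<comment> \<open>\<open>R\<close> may be negative, but \<open>ennreal\<close> truncates at 0;
    replacing \<open>R\<close> by its positive part only raises the integral.\<close>
  have "ennreal (\<integral>z. R z \<partial>P) \<le> ennreal (\<integral>z. max 0 (R z) \<partial>P)"
    using R(1) by (intro ennreal_leI integral_mono) auto
  also have "\<dots> = (\<integral>\<^sup>+z. ennreal (R z) \<partial>P)"
    using R(1) by (subst nn_integral_eq_integral[symmetric]) auto
  also have "\<dots> \<le> (\<integral>\<^sup>+z. ennreal ((norm (fst z - snd z))\<^sup>2) \<partial>P)"
    by (rule nn_integral_mono_AE) (use le in \<open>eventually_elim, simp add: ennreal_leI\<close>)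
  finally show ?thesis by (simp add: R s_def)
qed

text \<open>The coupling is the equality case of the lower bound. Nonnegativity of the value,
  required for undoing \<open>ennreal\<close>, holds because it is the integral of a square.\<close>

lemma gaussian_rank_one_optimal_coupling:
  fixes S :: "real^'n^'n::finite" and u :: "real^'n"
  assumes M: "centered_gaussian S M" and N: "centered_gaussian (rank_one u) N"
    and pos: "0 < u \<bullet> (S *v u)"
  defines "P \<equiv> distr M (M \<Otimes>\<^sub>M N) (\<lambda>x. (x, ((u \<bullet> x) / sqrt (u \<bullet> (S *v u))) *\<^sub>R u))"
  shows "P \<in> couplings M N"
    and "(\<integral>\<^sup>+z. ennreal ((norm (fst z - snd z))\<^sup>2) \<partial>P) =
      ennreal (trace S + (norm u)\<^sup>2 - 2 * sqrt (u \<bullet> (S *v u)))"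
    and "0 \<le> trace S + (norm u)\<^sup>2 - 2 * sqrt (u \<bullet> (S *v u))"
proof -
  define s where "s = sqrt (u \<bullet> (S *v u))"
  have s: "0 < s" "s\<^sup>2 = u \<bullet> (S *v u)" using pos by (simp_all add: s_def)
  have u: "u \<noteq> 0" using pos by auto
  have setsM [measurable_cong]: "sets M = sets borel" and setsN [measurable_cong]: "sets N = sets borel"
    using M N by (simp_all add: centered_gaussian_def)
  have P: "P = distr M (M \<Otimes>\<^sub>M N) (\<lambda>x. (x, ((u \<bullet> x) / s) *\<^sub>R u))"
    by (simp add: P_def s_def)
  have "distr P M fst = distr M M (\<lambda>x. x)"
    unfolding P by (subst distr_distr) (auto simp: o_def)
  also have "\<dots> = M" by (rule distr_id)
  finally have 1: "distr P M fst = M" .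
  \<comment> \<open>With this scaling \<open>v \<bullet> x\<close> is standard normal under
    \<open>M\<close>, so \<open>(v \<bullet> x) *\<^sub>R u\<close> has law
    \<open>N\<close>.\<close>
  define v where "v = (1 / s) *\<^sub>R u"
  have "v \<bullet> (S *v v) = 1"
    using s(1) by (simp add: v_def matrix_vector_mult_scaleR s(2)[symmetric] power2_eq_square)
  then have v: "distr M borel (\<lambda>x. v \<bullet> x) = centered_normal 1"
    by (simp add: gaussian_distr_inner[OF M])
  have "distr P N snd = distr M N (\<lambda>x. (v \<bullet> x) *\<^sub>R u)"
    unfolding P by (subst distr_distr) (auto simp: o_def v_def)
  also have "\<dots> = distr M borel (\<lambda>x. (v \<bullet> x) *\<^sub>R u)"
    by (rule distr_cong) (simp_all add: setsN)
  also have "\<dots> = distr (distr M borel (\<lambda>x. v \<bullet> x)) borel (\<lambda>z. z *\<^sub>R u)"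
    by (simp add: distr_distr o_def)
  also have "\<dots> = N"
    unfolding v using rank_one_gaussian_eq_distr[OF N u] by simp
  finally show "P \<in> couplings M N"
    using 1 by (simp add: couplings_def P)
  have eq: "(norm (x - ((u \<bullet> x) / s) *\<^sub>R u))\<^sup>2 =
      (norm x)\<^sup>2 + ((norm u)\<^sup>2 / s\<^sup>2 - 2 / s) * (u \<bullet> x)\<^sup>2" for x
    unfolding power2_norm_eq_inner using s(1)
    by (simp add: inner_diff_left inner_diff_right inner_commute power2_eq_square field_simps)
  have bi: "has_bochner_integral M (\<lambda>x. (norm (x - ((u \<bullet> x) / s) *\<^sub>R u))\<^sup>2)
      (trace S + ((norm u)\<^sup>2 / s\<^sup>2 - 2 / s) * s\<^sup>2)"
    unfolding eq
    using gaussian_integrable_norm_square[OF M] gaussian_integral_norm_square[OF M]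
      gaussian_integrable_inner_square[OF M, of u] gaussian_integral_inner_square[OF M, of u] s(2)
    by (intro has_bochner_integral_add has_bochner_integral_mult_right)
      (simp_all add: has_bochner_integral_iff)
  have val: "trace S + ((norm u)\<^sup>2 / s\<^sup>2 - 2 / s) * s\<^sup>2 = trace S + (norm u)\<^sup>2 - 2 * s"
    using s(1) by (simp add: power2_eq_square field_simps)
  have "(\<integral>\<^sup>+z. ennreal ((norm (fst z - snd z))\<^sup>2) \<partial>P) =
      (\<integral>\<^sup>+x. ennreal ((norm (x - ((u \<bullet> x) / s) *\<^sub>R u))\<^sup>2) \<partial>M)"
    unfolding P by (subst nn_integral_distr) auto
  also have "\<dots> = ennreal (trace S + (norm u)\<^sup>2 - 2 * s)"
    using bi val by (subst nn_integral_eq_integral) (auto simp: has_bochner_integral_iff)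
  finally show "(\<integral>\<^sup>+z. ennreal ((norm (fst z - snd z))\<^sup>2) \<partial>P) =
      ennreal (trace S + (norm u)\<^sup>2 - 2 * sqrt (u \<bullet> (S *v u)))"
    by (simp add: s_def)
  show "0 \<le> trace S + (norm u)\<^sup>2 - 2 * sqrt (u \<bullet> (S *v u))"
  proof -
    have "0 \<le> (\<integral>x. (norm (x - ((u \<bullet> x) / s) *\<^sub>R u))\<^sup>2 \<partial>M)" by simp
    then show ?thesis
      unfolding s_def[symmetric] val[symmetric] has_bochner_integral_integral_eq[OF bi] .
  qed
qed

lemma wasserstein_gaussian_rank_one:
  fixes S :: "real^'n^'n::finite" and u :: "real^'n"
  assumes "centered_gaussian S M" and "centered_gaussian (rank_one u) N"
    and "0 < u \<bullet> (S *v u)"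
  shows "wasserstein 2 M N = sqrt (trace S + (norm u)\<^sup>2 - 2 * sqrt (u \<bullet> (S *v u)))"
  by (rule wasserstein_2_eq_sqrt[OF gaussian_rank_one_optimal_coupling(1,2)[OF assms]
        gaussian_rank_one_cost_ge[OF assms] gaussian_rank_one_optimal_coupling(3)[OF assms]])

section \<open>The sum of AR(1) correlations and the distance as explicit functions of the
  parameter\<close>

definition ar1_sum :: "nat \<Rightarrow> real \<Rightarrow> real" where
  "ar1_sum n x = (\<Sum>i\<in>{1..n}. \<Sum>j\<in>{1..n}. x ^ nat \<bar>int i - int j\<bar>)"

text \<open>Bordering the correlation matrix adds one diagonal entry 1 and, in the new row and the
  new column, the powers with exponents 1 to \<open>n\<close>.\<close>

lemma ar1_sum_Suc: "ar1_sum (Suc n) x = ar1_sum n x + 1 + 2 * (\<Sum>k=1..n. x ^ k)"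
proof -
  have r: "(\<Sum>i\<in>{1..n}. x ^ nat \<bar>int i - int (Suc n)\<bar>) = (\<Sum>k=1..n. x ^ k)"
    by (rule sum.reindex_bij_witness[where i = "\<lambda>k. Suc n - k" and j = "\<lambda>k. Suc n - k"])
      (auto intro!: arg_cong[where f = "\<lambda>m. x ^ m"])
  have l: "(\<Sum>i\<in>{1..n}. x ^ nat \<bar>int (Suc n) - int i\<bar>) = (\<Sum>k=1..n. x ^ k)"
    using r by (simp add: abs_minus_commute)
  show ?thesis
    unfolding ar1_sum_def using l r by (simp add: sum.distrib)
qed

text \<open>Kept free of division so that it holds at \<open>x = 1\<close> as well; the right-hand
  side is the radicand of \<open>ar1_f\<close>.\<close>

lemma ar1_sum_closed:
  "(1 - x)\<^sup>2 * ar1_sum n x = real n * (1 - x\<^sup>2) - 2 * x * (1 - x ^ n)"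
proof (induction n)
  case 0
  then show ?case by (simp add: ar1_sum_def)
next
  case (Suc n)
  have g: "(1 - x) * (\<Sum>k=1..n. x ^ k) = x - x ^ Suc n"
  proof (induction n)
    case (Suc n)
    have "(1 - x) * (\<Sum>k=1..Suc n. x ^ k) = (1 - x) * (\<Sum>k=1..n. x ^ k) + (1 - x) * x ^ Suc n"
      by (simp add: distrib_left)
    also have "\<dots> = x - x ^ Suc (Suc n)"
      unfolding Suc.IH by (simp add: algebra_simps)
    finally show ?case .
  qed simp
  have "(1 - x)\<^sup>2 * ar1_sum (Suc n) x =
      (1 - x)\<^sup>2 * ar1_sum n x + (1 - x)\<^sup>2 + 2 * (1 - x) * ((1 - x) * (\<Sum>k=1..n. x ^ k))"
    by (simp add: ar1_sum_Suc power2_eq_square algebra_simps)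
  also have "\<dots> = real (Suc n) * (1 - x\<^sup>2) - 2 * x * (1 - x ^ Suc n)"
    unfolding g Suc.IH by (simp add: power2_eq_square algebra_simps)
  finally show ?case .
qed

lemma ar1_sum_1: "ar1_sum n 1 = (real n)\<^sup>2"
  by (simp add: ar1_sum_def power2_eq_square)

lemma ar1_sum_minus_1: "ar1_sum n (-1) = (1 - (-1) ^ n) / 2"
  using ar1_sum_closed[of "-1" n] by simp

lemma continuous_on_ar1_sum: "continuous_on A (ar1_sum n)"
  unfolding ar1_sum_def by (intro continuous_intros)

text \<open>Up to the factor \<open>2 / (1 - x)\<^sup>3\<close> this is the derivative of \<^const>\<open>ar1_sum\<close>.\<close>

definition ar1_num :: "nat \<Rightarrow> real \<Rightarrow> real" where
  "ar1_num n x = (real n * x ^ n - 1 + x ^ n - real n * x) * (1 - x)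
     + (real n * (1 - x\<^sup>2) - 2 * x * (1 - x ^ n))"

lemma ar1_num_expand:
  "ar1_num n x = (real n - 1) - (real n + 1) * x + (real n + 1) * x ^ n - (real n - 1) * x ^ Suc n"
  by (simp add: ar1_num_def power2_eq_square algebra_simps)

text \<open>For negative \<open>x\<close> the parity of \<open>n\<close> fixes the signs of the
  powers, and the expanded form splits into nonnegative pieces with one strictly positive. For
  \<open>x \<ge> 0\<close> induction on \<open>n\<close> works, with increments
  \<open>(1 - x) * e m\<close>.\<close>

lemma ar1_num_pos:
  assumes n: "n \<ge> 2" and x: "-1 < x" "x < 1"
  shows "0 < ar1_num n x"
proof (cases "x < 0")
  case True
  define y where "y = - x"
  have y: "0 < y" "y < 1" "x = - y" using True x by (auto simp: y_def)
  show ?thesis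
  proof (cases "even n")
    case True
    then have "ar1_num n x = (real n - 1) + (real n + 1) * y + (real n + 1) * y ^ n + (real n - 1) * y ^ Suc n"
      unfolding ar1_num_expand y(3) by (simp add: power_minus_even)
    moreover have "0 < (real n - 1)" "0 \<le> (real n + 1) * y" "0 \<le> (real n + 1) * y ^ n" "0 \<le> (real n - 1) * y ^ Suc n"
      using y n by simp_all
    ultimately show ?thesis by linarith
  next
    case False
    then have "ar1_num n x = (real n - 1) * (1 - y ^ Suc n) + (real n + 1) * (y - y ^ n)"
      unfolding ar1_num_expand y(3) by (simp add: power_minus_odd algebra_simps)
    moreover have "y ^ Suc n < 1" using y power_Suc_less_one[of y n] by blast
    moreover have "y ^ n \<le> y" using y n power_decreasing[of 1 n y] by simp
    ultimately show ?thesis using n by (simp add: add_pos_nonneg)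
  qed
next
  case False
  then have x0: "0 \<le> x" by simp
  \<comment> \<open>In closed form \<open>e m\<close> is \<open>(1 - x)\<^sup>2\<close> times the
    sum of \<open>k * x ^ (k - 1)\<close> for \<open>k\<close> from 1 to \<open>m\<close>; the
    recursion \<open>eS\<close> expresses this.\<close>
  define e where "e m = 1 - (real m + 1) * x ^ m + real m * x ^ Suc m" for m
  have eS: "e (Suc m) = e m + (real m + 1) * x ^ m * (1 - x)\<^sup>2" for m
    by (simp add: e_def power2_eq_square algebra_simps)
  have e: "0 \<le> e m" for m
  proof (induction m)
    case 0 show ?case by (simp add: e_def)
  next
    case (Suc m) then show ?case unfolding eS using x0 by (intro add_nonneg_nonneg mult_nonneg_nonneg) simp_all
  qed
  have S: "ar1_num (Suc m) x = ar1_num m x + (1 - x) * e m" for m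
    by (simp add: ar1_num_expand e_def algebra_simps)
  \<comment> \<open>Strictness enters at the base: \<open>ar1_num 1 x\<close> is 0, so
    \<open>ar1_num 2 x\<close> equals \<open>(1 - x) ^ 3\<close>.\<close>
  have "e 1 = (1 - x)\<^sup>2" by (simp add: e_def power2_eq_square algebra_simps)
  then have "0 < ar1_num 2 x"
    using S[of 1] x by (simp add: numeral_2_eq_2 ar1_num_expand)
  with n show ?thesis
  proof (induction n rule: dec_induct)
    case base then show ?case by simp
  next
    case (step m)
    then show ?case unfolding S using e[of m] x by (intro add_pos_nonneg) simp_all
  qed
qed

lemma ar1_sum_has_derivative:
  assumes "x < 1"
  shows "(ar1_sum n has_real_derivative 2 * ar1_num n x / (1 - x) ^ 3) (at x)"
proof (rule has_field_derivative_transform_within_open)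
  let ?r = "\<lambda>x. real n * (1 - x\<^sup>2) - 2 * x * (1 - x ^ n)"
  define r' where "r' = 2 * (real n * x ^ n - 1 + x ^ n - real n * x)"
  \<comment> \<open>The power rule yields \<open>x ^ (n - 1)\<close>; the case split covers
    \<open>n = 0\<close>, where the subtraction truncates.\<close>
  have "real n * x ^ n = x * (real n * x ^ (n - 1))"
    by (cases n) simp_all
  then have r: "(?r has_real_derivative r') (at x)"
    by (auto intro!: derivative_eq_intros simp: r'_def algebra_simps)
  have d: "((\<lambda>x. (1 - x)\<^sup>2) has_real_derivative - 2 * (1 - x)) (at x)"
    by (auto intro!: derivative_eq_intros)
  \<comment> \<open>The numerator of the quotient rule contains a factor \<open>1 - x\<close>, which
    lowers the fourth power in the denominator to a cube.\<close>
  have "r' * (1 - x)\<^sup>2 - ?r x * (- 2 * (1 - x)) = (1 - x) * (2 * ar1_num n x)"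
    by (simp add: r'_def ar1_num_def power2_eq_square algebra_simps)
  then have "(r' * (1 - x)\<^sup>2 - ?r x * (- 2 * (1 - x))) / ((1 - x)\<^sup>2 * (1 - x)\<^sup>2)
      = 2 * ar1_num n x / (1 - x) ^ 3"
    using assms by (simp only: power2_eq_square power3_eq_cube) simp
  with DERIV_divide[OF r d] assms
  show "((\<lambda>x. ?r x / (1 - x)\<^sup>2) has_real_derivative 2 * ar1_num n x / (1 - x) ^ 3) (at x)"
    by simp
  show "open {..<1::real}" "x \<in> {..<1}" using assms by auto
  show "\<And>y. y \<in> {..<1} \<Longrightarrow> (real n * (1 - y\<^sup>2) - 2 * y * (1 - y ^ n)) / (1 - y)\<^sup>2 = ar1_sum n y"
    unfolding ar1_sum_closed[symmetric] by simp
qed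

text \<open>A positive derivative on the open interval suffices; continuity extends the comparison
  to the endpoints, whose explicit values are used below.\<close>

lemma ar1_sum_strict_mono:
  assumes "n \<ge> 2" and "-1 \<le> x" "x < y" "y \<le> 1"
  shows "ar1_sum n x < ar1_sum n y"
proof (rule DERIV_pos_imp_increasing_open[OF \<open>x < y\<close>])
  fix t assume "x < t" "t < y"
  then have "-1 < t" "t < 1" using assms by auto
  then show "\<exists>d. (ar1_sum n has_real_derivative d) (at t) \<and> 0 < d"
    using ar1_sum_has_derivative[of t n] ar1_num_pos[OF assms(1), of t]
    by (intro exI[of _ "2 * ar1_num n t / (1 - t) ^ 3"]) auto
qed (rule continuous_on_ar1_sum)

text \<open>Written with \<open>ar1_sum\<close> instead of \<open>ar1_f n x / (1 - x)\<close>, the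
  function is continuous at 1 too, so boundary limits are plain values.\<close>

definition ar1_dist :: "nat \<Rightarrow> real \<Rightarrow> real \<Rightarrow> real" where
  "ar1_dist n \<sigma> x = sqrt 2 * \<sigma> * sqrt (real n - sqrt (ar1_sum n x))"

lemma continuous_on_ar1_dist: "continuous_on A (ar1_dist n \<sigma>)"
  unfolding ar1_dist_def by (intro continuous_intros continuous_on_ar1_sum)

lemma ar1_dist_1: "ar1_dist n \<sigma> 1 = 0"
  by (simp add: ar1_dist_def ar1_sum_1)

lemma ar1_dist_minus_1: "ar1_dist n \<sigma> (-1) = ar1_c n \<sigma>"
proof -
  have "2 * sqrt ((1 - (-1) ^ n) / 2) = sqrt 2 * sqrt (1 - (-1) ^ n)"
    by (simp add: real_sqrt_divide field_simps)
  then have "2 * (real n - sqrt (ar1_sum n (-1))) = 2 * real n - sqrt 2 * sqrt (1 - (-1) ^ n)"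
    by (simp add: ar1_sum_minus_1 algebra_simps)
  then have "sqrt 2 * sqrt (real n - sqrt (ar1_sum n (-1))) = sqrt (2 * real n - sqrt 2 * sqrt (1 - (-1) ^ n))"
    by (metis real_sqrt_mult)
  then show ?thesis by (simp add: ar1_dist_def ar1_c_def)
qed

lemma ar1_dist_strict_antimono:
  assumes "n \<ge> 2" and "\<sigma> > 0" and "-1 \<le> x" "x < y" "y \<le> 1"
  shows "ar1_dist n \<sigma> y < ar1_dist n \<sigma> x"
  using ar1_sum_strict_mono[OF assms(1,3-5)] assms(2) by (simp add: ar1_dist_def)

text \<open>Strict monotonicity against the endpoint values. Both bounds keep the arguments of the
  nested square roots positive, as differentiation requires.\<close>

lemma ar1_sum_bounds:
  assumes n: "n \<ge> 2" and x: "-1 < x" "x < 1"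
  shows "0 < ar1_sum n x" and "sqrt (ar1_sum n x) < real n"
proof -
  have "0 \<le> ar1_sum n (-1)"
    unfolding ar1_sum_minus_1 by (cases "even n") auto
  also have "\<dots> < ar1_sum n x" using ar1_sum_strict_mono[of n "-1" x] assms by simp
  finally show "0 < ar1_sum n x" .
  have "ar1_sum n x < (real n)\<^sup>2"
    using ar1_sum_strict_mono[of n x 1] assms by (simp add: ar1_sum_1)
  then show "sqrt (ar1_sum n x) < real n" by (simp add: real_less_lsqrt)
qed

lemma sqrt_ar1_sum:
  assumes "x < 1"
  shows "sqrt (ar1_sum n x) = ar1_f n x / (1 - x)"
proof -
  have "ar1_f n x = (1 - x) * sqrt (ar1_sum n x)"
    using assms unfolding ar1_f_def ar1_sum_closed[symmetric] by (simp add: real_sqrt_mult)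
  with assms show ?thesis by simp
qed

lemma ar1_dist_has_derivative:
  assumes n: "n \<ge> 2" and x: "-1 < x" "x < 1"
  shows "(ar1_dist n \<sigma> has_real_derivative
    - (\<sigma> * (ar1_num n x / (sqrt 2 * ar1_f n x * sqrt (real n - ar1_f n x / (1 - x)) * (1 - x)\<^sup>2)))) (at x)"
proof -
  define q where "q = sqrt (ar1_sum n x)"
  define r where "r = sqrt (real n - q)"
  have q: "0 < q" "0 < r" using ar1_sum_bounds[OF assms] by (simp_all add: q_def r_def)
  have f: "ar1_f n x = q * (1 - x)" using sqrt_ar1_sum[OF x(2), of n] x by (simp add: q_def)
  have "(ar1_dist n \<sigma> has_real_derivative
      sqrt 2 * \<sigma> * ((0 - (2 * ar1_num n x / (1 - x) ^ 3) * (inverse q / 2)) * (inverse r / 2))) (at x)"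
    unfolding ar1_dist_def q_def r_def using ar1_sum_bounds[OF assms] x
    by (auto intro!: derivative_eq_intros ar1_sum_has_derivative simp: field_simps)
  \<comment> \<open>One factor of the cube \<open>(1 - x) ^ 3\<close> is absorbed by
    \<open>ar1_f n x = q * (1 - x)\<close>.\<close>
  moreover have "sqrt 2 * \<sigma> * ((0 - (2 * ar1_num n x / (1 - x) ^ 3) * (inverse q / 2)) * (inverse r / 2))
     = - (\<sigma> * (ar1_num n x / (sqrt 2 * ar1_f n x * sqrt (real n - ar1_f n x / (1 - x)) * (1 - x)\<^sup>2)))"
  proof -
    have "sqrt (real n - ar1_f n x / (1 - x)) = r" using x by (simp add: f r_def)
    moreover have "sqrt 2 * (sqrt 2 * (1 - x)) = 2 - x * 2"
      by (simp add: mult.assoc[symmetric])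
    ultimately show ?thesis using q x unfolding f
      by (simp add: divide_simps power2_eq_square power3_eq_cube)
  qed
  ultimately show ?thesis by simp
qed

section \<open>The AR(1) family: its distance to the base measure and its prior density\<close>

lemma wasserstein_ar1:
  fixes idx :: "'n::finite \<Rightarrow> nat" and \<mu> :: "real \<Rightarrow> (real^'n) measure"
  assumes n: "n \<ge> 2" and \<sigma>: "\<sigma> > 0" and idx: "bij_betw idx UNIV {1..n}"
    and G: "\<And>\<phi>. \<phi> \<in> {-1..1} \<Longrightarrow> centered_gaussian (ar1_cov idx \<sigma> \<phi>) (\<mu> \<phi>)"
    and \<phi>: "-1 < \<phi>" "\<phi> < 1"
  shows "wasserstein 2 (\<mu> \<phi>) (\<mu> 1) = ar1_dist n \<sigma> \<phi>"
proof -
  define u :: "real^'n" where "u = (\<chi> i. \<sigma>)"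
  let ?S = "ar1_cov idx \<sigma> \<phi>"
  have card: "CARD('n) = n"
    using bij_betw_same_card[OF idx] by simp
  have "ar1_cov idx \<sigma> 1 = rank_one u"
    by (simp add: ar1_cov_def rank_one_def u_def power2_eq_square vec_eq_iff)
  then have N: "centered_gaussian (rank_one u) (\<mu> 1)" using G[of 1] by simp
  have M: "centered_gaussian ?S (\<mu> \<phi>)" using G \<phi> by simp
  have "u \<bullet> (?S *v u) = \<sigma> ^ 4 * (\<Sum>i\<in>UNIV. \<Sum>j\<in>UNIV. \<phi> ^ nat \<bar>int (idx i) - int (idx j)\<bar>)"
    by (simp add: inner_vec_def matrix_vector_mult_def u_def ar1_cov_def sum_distrib_left
        power2_eq_square eval_nat_numeral algebra_simps)
  \<comment> \<open>Both sums move along the bijection \<open>idx\<close> from coordinates to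
    \<open>{1..n}\<close>, where the results proved by induction on \<open>n\<close> apply.\<close>
  also have "(\<Sum>i\<in>UNIV. \<Sum>j\<in>UNIV. \<phi> ^ nat \<bar>int (idx i) - int (idx j)\<bar>) = ar1_sum n \<phi>"
    unfolding ar1_sum_def
    by (subst sum.reindex_bij_betw[OF idx, symmetric], rule sum.cong[OF refl],
        subst sum.reindex_bij_betw[OF idx, symmetric], rule refl)
  finally have uSu: "u \<bullet> (?S *v u) = (\<sigma>\<^sup>2)\<^sup>2 * ar1_sum n \<phi>" by simp
  have tr: "trace ?S = real n * \<sigma>\<^sup>2" "(norm u)\<^sup>2 = real n * \<sigma>\<^sup>2"
    unfolding power2_norm_eq_inner
    by (simp_all add: trace_def ar1_cov_def inner_vec_def u_def power2_eq_square card)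
  \<comment> \<open>The quadratic form must be positive here; at \<open>\<phi> = -1\<close> it would
    vanish for even \<open>n\<close>.\<close>
  have "wasserstein 2 (\<mu> \<phi>) (\<mu> 1) = sqrt (trace ?S + (norm u)\<^sup>2 - 2 * sqrt (u \<bullet> (?S *v u)))"
    using uSu ar1_sum_bounds(1)[OF n \<phi>] \<sigma> by (intro wasserstein_gaussian_rank_one[OF M N]) simp
  also have "\<dots> = sqrt (2 * \<sigma>\<^sup>2 * (real n - sqrt (ar1_sum n \<phi>)))"
  proof -
    have "sqrt (u \<bullet> (?S *v u)) = \<sigma>\<^sup>2 * sqrt (ar1_sum n \<phi>)"
      unfolding uSu real_sqrt_mult real_sqrt_abs by simp
    then show ?thesis by (simp add: tr algebra_simps)
  qed
  also have "\<dots> = ar1_dist n \<sigma> \<phi>"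
    using \<sigma> by (simp add: ar1_dist_def real_sqrt_mult)
  finally show ?thesis .
qed

theorem proposition4:
  fixes n :: nat and \<sigma> \<eta> :: real
    and idx :: "'n::finite \<Rightarrow> nat"
    and \<mu> :: "real \<Rightarrow> (real^'n) measure"
  assumes "n \<ge> 2" and "\<sigma> > 0" and "\<eta> > 0"
    and "bij_betw idx UNIV {1..n}"
    and "\<And>\<phi>. \<phi> \<in> {-1..1} \<Longrightarrow> centered_gaussian (ar1_cov idx \<sigma> \<phi>) (\<mu> \<phi>)"
  shows "wcp_model 2 (-1) 1 1 \<mu> (\<mu> 1) \<and>
    wcp_sup 2 (-1) 1 \<mu> (\<mu> 1) = ereal (ar1_c n \<sigma>) \<and>
    (\<forall>\<phi>\<in>{-1<..<1}.
      wcp_density 2 (-1) 1 \<mu> (\<mu> 1) \<eta> \<phi> =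
        \<sigma> * \<bar>((real n * \<phi> ^ n - 1 + \<phi> ^ n - real n * \<phi>) * (1 - \<phi>) + (ar1_f n \<phi>)\<^sup>2) /
              (sqrt 2 * ar1_f n \<phi> * sqrt (real n - ar1_f n \<phi> / (1 - \<phi>)) * (1 - \<phi>)\<^sup>2)\<bar> *
        (\<eta> * exp (- sqrt 2 * \<eta> * \<sigma> * sqrt (real n - ar1_f n \<phi> / (1 - \<phi>))) /
              (1 - exp (- \<eta> * ar1_c n \<sigma>))))"
proof -
  note n = \<open>n \<ge> 2\<close> and \<sigma> = \<open>\<sigma> > 0\<close>
  define I where "I = {-1<..<1::real}"
  define W where "W \<phi> = wasserstein 2 (\<mu> \<phi>) (\<mu> 1)" for \<phi>
  let ?V = "ar1_dist n \<sigma>"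
  \<comment> \<open>The identity is available on the open interval only, so limits of
    \<open>W\<close> are taken within \<open>I\<close>, and derivatives transfer because
    \<open>I\<close> is open.\<close>
  have W: "W \<phi> = ?V \<phi>" if "\<phi> \<in> I" for \<phi>
    using wasserstein_ar1[OF n \<sigma> assms(4,5)] that by (simp add: W_def I_def)
  have V_tendsto: "(?V \<longlongrightarrow> ?V a) (at a within I)" for a
    using continuous_on_ar1_dist[of UNIV n \<sigma>]
    by (auto simp: continuous_on_def intro: tendsto_within_subset)
  have W_tendsto: "(W \<longlongrightarrow> ?V a) (at a within I)" for a
    by (rule Lim_transform_eventually[OF V_tendsto]) (auto simp: eventually_at_filter W)
  have W_deriv: "(W has_real_derivative
      - (\<sigma> * (ar1_num n \<phi> / (sqrt 2 * ar1_f n \<phi> * sqrt (real n - ar1_f n \<phi> / (1 - \<phi>)) * (1 - \<phi>)\<^sup>2)))) (at \<phi>)"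
    if "\<phi> \<in> I" for \<phi>
    proof (rule has_field_derivative_transform_within_open)
    show "(?V has_real_derivative
        - (\<sigma> * (ar1_num n \<phi> / (sqrt 2 * ar1_f n \<phi> * sqrt (real n - ar1_f n \<phi> / (1 - \<phi>)) * (1 - \<phi>)\<^sup>2)))) (at \<phi>)"
      using that by (intro ar1_dist_has_derivative[OF n]) (simp_all add: I_def)
    show "open I" by (simp add: I_def)
  qed (use that W in auto)
  have c_pos: "0 < ar1_c n \<sigma>"
    using ar1_dist_strict_antimono[OF n \<sigma>, of "-1" 1] by (simp add: ar1_dist_1 ar1_dist_minus_1)
  have sup: "wcp_sup 2 (-1) 1 \<mu> (\<mu> 1) = ereal (ar1_c n \<sigma>)"
    unfolding wcp_sup_def W_def[symmetric] I_def[symmetric]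
  \<comment> \<open>The supremum is not attained on \<open>I\<close>: strict antimonotonicity bounds
    \<open>W\<close> by the value of \<open>?V\<close> at -1, and that value is the limit of
    \<open>W\<close> there.\<close>
  proof (rule SUP_eqI)
    fix \<phi> assume "\<phi> \<in> I"
    then show "ereal (W \<phi>) \<le> ereal (ar1_c n \<sigma>)"
      using ar1_dist_strict_antimono[OF n \<sigma>, of "-1" \<phi>]
      by (simp add: W ar1_dist_minus_1) (simp add: I_def)
  next
    fix y assume y: "\<And>\<phi>. \<phi> \<in> I \<Longrightarrow> ereal (W \<phi>) \<le> y"
    have "((\<lambda>\<phi>. ereal (W \<phi>)) \<longlongrightarrow> ereal (ar1_c n \<sigma>)) (at (-1) within I)"
      using W_tendsto[of "-1"] by (simp add: ar1_dist_minus_1)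
    moreover have "\<forall>\<^sub>F \<phi> in at (-1) within I. ereal (W \<phi>) \<le> y"
      using y by (simp add: eventually_at_filter)
    moreover have "at (-1) within I \<noteq> bot"
      by (simp add: I_def at_within_eq_bot_iff)
    ultimately show "ereal (ar1_c n \<sigma>) \<le> y"
      by (rule tendsto_upperbound)
  qed
  have "inj_on W I"
  proof (rule linorder_inj_onI)
    fix x y assume "x < y" "x \<in> I" "y \<in> I"
    then show "W x \<noteq> W y"
      using ar1_dist_strict_antimono[OF n \<sigma>, of x y] W by (auto simp: I_def)
  qed (auto simp: I_def)
  moreover have "W differentiable_on I"
    using W_deriv by (meson differentiable_at_imp_differentiable_on real_differentiable_def)
  moreover have "finite_moment 2 (\<mu> \<phi>)" if "\<phi> \<in> {-1..1}" for \<phi>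
    using gaussian_finite_moment[OF assms(5)[OF that]] .
  \<comment> \<open>The base endpoint 1 is the upper one, so the limit 0 is taken at 1 and the limit
    equal to the supremum at -1.\<close>
  ultimately have model: "wcp_model 2 (-1) 1 1 \<mu> (\<mu> 1)"
    using W_tendsto[of 1] W_tendsto[of "-1"] c_pos
    unfolding wcp_model_def sup W_def[symmetric] I_def[symmetric]
    by (auto simp: ar1_dist_1 ar1_dist_minus_1 I_def)
  have "wcp_density 2 (-1) 1 \<mu> (\<mu> 1) \<eta> \<phi> =
        \<sigma> * \<bar>((real n * \<phi> ^ n - 1 + \<phi> ^ n - real n * \<phi>) * (1 - \<phi>) + (ar1_f n \<phi>)\<^sup>2) /
              (sqrt 2 * ar1_f n \<phi> * sqrt (real n - ar1_f n \<phi> / (1 - \<phi>)) * (1 - \<phi>)\<^sup>2)\<bar> *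
        (\<eta> * exp (- sqrt 2 * \<eta> * \<sigma> * sqrt (real n - ar1_f n \<phi> / (1 - \<phi>))) /
              (1 - exp (- \<eta> * ar1_c n \<sigma>)))" if "\<phi> \<in> I" for \<phi>
  proof -
    have \<phi>: "-1 < \<phi>" "\<phi> < 1" using that by (auto simp: I_def)
    \<comment> \<open>A nonnegative radicand makes \<open>(ar1_f n \<phi>)\<^sup>2\<close> equal to
      it, which turns \<open>ar1_num\<close> into the numerator of the claim.\<close>
    have "0 \<le> (1 - \<phi>)\<^sup>2 * ar1_sum n \<phi>"
      using ar1_sum_bounds(1)[OF n \<phi>] by simp
    then have num: "ar1_num n \<phi> = (real n * \<phi> ^ n - 1 + \<phi> ^ n - real n * \<phi>) * (1 - \<phi>) + (ar1_f n \<phi>)\<^sup>2"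
      by (simp add: ar1_num_def ar1_f_def ar1_sum_closed)
    have dist: "W \<phi> = sqrt 2 * \<sigma> * sqrt (real n - ar1_f n \<phi> / (1 - \<phi>))"
      using W[OF that] sqrt_ar1_sum[OF \<phi>(2)] by (simp add: ar1_dist_def)
    show ?thesis
      unfolding wcp_density_def sup Let_def W_def[symmetric] dist
        DERIV_imp_deriv[OF W_deriv[OF that]] num
      using \<sigma> by (simp add: abs_mult mult_ac)
  qed
  with model sup show ?thesis by (simp add: I_def)
qed

end
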